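(* Let $a,r\in(0,\infty)$ and $b,c\in(1,\infty)$. Let $f,g:(0,\infty)\to[0,\infty)$ be measurable functions, and assume $g$ is $c$-adically decreasing. If $f$ is $b$-almost decreasing, then $$\int_0^rg(t)f(t)t^{a-1}\,dt\ge\frac{a(cr)^{-a}}{b^3}\Big(\int_0^rg(t)t^{a-1}\,dt\Big)\Big(\int_0^{cr}f(t)t^{a-1}\,dt\Big),$$ $$\int_r^\infty g(t)f(t)t^{-a-1}\,dt\ge\frac{a(cr)^a}{b^3}\Big(\int_r^\infty g(t)t^{-a-1}\,dt\Big)\Big(\int_{cr}^\infty f(t)t^{-a-1}\,dt\Big).$$ If $f$ is $b$-almost increasing, then $$\int_0^rg(t)f(t)t^{a-1}\,dt\le a(cr)^{-a}b^3\Big(\int_0^rg(t)t^{a-1}\,dt\Big)\Big(\int_0^{cr}f(t)t^{a-1}\,dt\Big),$$ $$\int_r^\infty g(t)f(t)t^{-a-1}\,dt\le a(cr)^ab^3\Big(\int_r^\infty g(t)t^{-a-1}\,dt\Big)\Big(\int_{cr}^\infty f(t)t^{-a-1}\,dt\Big).$$ Moreover, if $g$ is decreasing (in the ordinary sense), then $b^3$ can be replaced by $b$ in all these estimates.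
   Context: $g$ is $c$-adically decreasing if $g(ct)\le g(t)$ for all $t>0$. $f$ is $b$-almost decreasing if $x\le y$ implies $f(y)\le bf(x)$, and $b$-almost increasing if $x\le y$ implies $f(x)\le bf(y)$. Integrals take values in $[0,\infty]$. *)

theory Defs
  imports "HOL-Analysis.Analysis"
begin

text \<open>Functions on $(0,\infty)$ are represented by total functions on the reals; only their
  values on \<open>{0<..}\<close> matter.\<close>

definition adically_decreasing :: "real \<Rightarrow> (real \<Rightarrow> real) \<Rightarrow> bool" where
  "adically_decreasing c g \<longleftrightarrow> (\<forall>t>0. g (c * t) \<le> g t)"

definition almost_decreasing :: "real \<Rightarrow> (real \<Rightarrow> real) \<Rightarrow> bool" where
  "almost_decreasing b f \<longleftrightarrow> (\<forall>x>0. \<forall>y>0. x \<le> y \<longrightarrow> f y \<le> b * f x)"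

definition almost_increasing :: "real \<Rightarrow> (real \<Rightarrow> real) \<Rightarrow> bool" where
  "almost_increasing b f \<longleftrightarrow> (\<forall>x>0. \<forall>y>0. x \<le> y \<longrightarrow> f x \<le> b * f y)"

end

theory Submission
  imports Defs
begin

text \<open>
  The idea is to read each estimate as a comparison of two measures, tested against a monotone
  function. Near 0, let $\mu$ be the measure $g(t) t^{a-1}\,dt$ on $(0,r)$, of total mass $m$, and
  let $\nu$ be the probability measure $a (cr)^{-a} t^{a-1}\,dt$ on $(0,cr)$. Up to powers of
  $b$, the claim compares $\int f\,d\mu$ with $m \int f\,d\nu$. Near infinity the same holds with
  $a$ replaced by $-a$ and the intervals by $(r,\infty)$ and $(cr,\infty)$.

  By the layer-cake formula it suffices to compare $\mu$ with $m\nu$ on lower sets if \<open>f\<close> is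
  almost decreasing, and on upper sets if \<open>f\<close> is almost increasing
  (\<open>nn_integral_mono_of_hereditary_sets\<close>). Almost monotonicity costs one factor $b$ only:
  the hereditary hull of a level set of \<open>f\<close> lies in the corresponding level set of $bf$.

  Since $g(ct) \le g(t)$, dilating a set by $c^n$ multiplies its mass for $g(t) t^{p-1}\,dt$ by at
  most $c^{np}$ (\<open>emeasure_weighted_scale_le\<close>). Rounding ratios of endpoints to powers of $c$
  gives $\mu((0,s)) \ge (s/cr)^a m = m\,\nu((0,s))$ for $s < r$ near 0, and
  $\mu((s,\infty)) \le (cr/s)^a m = m\,\nu((s,\infty))$ for $s > cr$ near infinity
  (\<open>weighted_initial_ge\<close>, \<open>weighted_tail_le\<close>). This is the comparison on lower sets near 0
  and on upper sets near infinity. The other two follow by taking complements when $m$ is finite;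
  when $m$ is infinite they are checked directly, with \<open>weighted_shell_infinite\<close> near infinity.

  The argument yields the constant $b$ for $c$-adically decreasing $g$, and the estimates with $b^3$
  follow because $b \le b^3$.
\<close>

section \<open>Layer-cake comparison of weighted integrals\<close>

lemma sigma_finite_lebesgue: "sigma_finite_measure (lebesgue :: real measure)"
proof
  show "\<exists>A::real set set. countable A \<and> A \<subseteq> sets lebesgue \<and> \<Union> A = space lebesgue
          \<and> (\<forall>a\<in>A. emeasure lebesgue a \<noteq> \<infinity>)"
  proof (intro exI conjI)
    show "\<Union> (range (\<lambda>n::nat. {- real n..real n})) = space lebesgue"
      by (auto intro: exI[of _ "nat \<lceil>\<bar>x\<bar>\<rceil>" for x]) (metis abs_le_iff minus_le_iff real_arch_simple)
  qed auto
qed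

text \<open>Write $f(x)$ as the length of \<open>{0..<f x}\<close> and exchange the order of integration. The weight
  \<open>w\<close> enters as an integrand rather than as a measure, so that \<open>M\<close> alone has to be
  \<open>\<sigma>\<close>-finite and \<open>w\<close> may take the value \<open>\<infinity>\<close>.\<close>

lemma nn_integral_layer_cake:
  fixes f :: "'a \<Rightarrow> real" and w :: "'a \<Rightarrow> ennreal"
  assumes "sigma_finite_measure M"
    and [measurable]: "f \<in> borel_measurable M" "w \<in> borel_measurable M"
  shows "(\<integral>\<^sup>+x. ennreal (f x) * w x \<partial>M) =
    (\<integral>\<^sup>+l\<in>{0..}. (\<integral>\<^sup>+x\<in>{x. l < f x}. w x \<partial>M) \<partial>lborel)"
proof -
  interpret sigma_finite_measure M by fact
  interpret pair_sigma_finite M "lborel :: real measure" ..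
  \<comment> \<open>At negative levels \<open>h\<close> vanishes, so that a negative value of \<open>f\<close> contributes 0,
    as \<open>ennreal\<close> of it does.\<close>
  define h where "h x l = w x * indicator {x. 0 \<le> l \<and> l < f x} x" for x and l :: real
  have h_alt: "h x l = (if 0 \<le> l \<and> l < f x then w x else 0)" for x l
    by (simp add: h_def indicator_def)
  have "(\<integral>\<^sup>+x. ennreal (f x) * w x \<partial>M) = (\<integral>\<^sup>+x. (\<integral>\<^sup>+l. h x l \<partial>lborel) \<partial>M)"
  proof (intro nn_integral_cong)
    fix x
    have "(\<integral>\<^sup>+l. h x l \<partial>lborel) = (\<integral>\<^sup>+l. w x * indicator {0..<f x} l \<partial>lborel)"
      by (intro nn_integral_cong) (auto simp: h_def indicator_def)
    also have "\<dots> = w x * emeasure lborel {0..<f x}"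
      by (simp add: nn_integral_cmult_indicator)
    also have "emeasure lborel {0..<f x} = ennreal (f x)"
      by (cases "0 \<le> f x") (auto simp: ennreal_neg)
    finally show "ennreal (f x) * w x = (\<integral>\<^sup>+l. h x l \<partial>lborel)"
      by (simp add: mult.commute)
  qed
  also have "\<dots> = (\<integral>\<^sup>+l. (\<integral>\<^sup>+x. h x l \<partial>M) \<partial>lborel)"
    unfolding h_alt by (rule Fubini'[symmetric]) measurable
  also have "\<dots> = (\<integral>\<^sup>+l\<in>{0..}. (\<integral>\<^sup>+x\<in>{x. l < f x}. w x \<partial>M) \<partial>lborel)"
    by (intro nn_integral_cong) (auto simp: h_def indicator_def)
  finally show ?thesis .
qed

text \<open>The superlevel sets of an almost monotone \<open>f\<close> need not be hereditary, but closing
  \<open>{x. l < f x}\<close> under \<open>R\<close> stays inside \<open>{x. l < b * f x}\<close>. So an inequality between two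
  weights on hereditary sets passes to the integrals of \<open>f\<close> at the cost of a single factor
  \<open>b\<close>: integrate it over all levels. With \<open>R\<close> being \<open>\<ge>\<close> (respectively \<open>\<le>\<close>) this covers
  almost decreasing (respectively almost increasing) functions.\<close>

lemma nn_integral_mono_of_hereditary_sets:
  fixes f :: "real \<Rightarrow> real" and u v :: "real \<Rightarrow> ennreal"
  assumes [measurable]: "f \<in> borel_measurable lebesgue" "u \<in> borel_measurable lebesgue"
      "v \<in> borel_measurable lebesgue"
    and supp: "\<And>x. x \<notin> A \<Longrightarrow> f x \<le> 0" and "0 \<le> b"
    and R: "reflp R" "transp R"
    and f: "\<And>x y. x \<in> A \<Longrightarrow> y \<in> A \<Longrightarrow> R x y \<Longrightarrow> f x \<le> b * f y"
    and uv: "\<And>S. S \<subseteq> A \<Longrightarrow> (\<And>x y. x \<in> S \<Longrightarrow> y \<in> A \<Longrightarrow> R x y \<Longrightarrow> y \<in> S) \<Longrightarrow>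
      (\<integral>\<^sup>+x\<in>S. u x \<partial>lebesgue) \<le> (\<integral>\<^sup>+x\<in>S. v x \<partial>lebesgue)"
  shows "(\<integral>\<^sup>+x. ennreal (f x) * u x \<partial>lebesgue) \<le> ennreal b * (\<integral>\<^sup>+x. ennreal (f x) * v x \<partial>lebesgue)"
proof -
  have level: "(\<integral>\<^sup>+x\<in>{x. l < f x}. u x \<partial>lebesgue) \<le> (\<integral>\<^sup>+x\<in>{x. l < b * f x}. v x \<partial>lebesgue)"
    if "0 \<le> l" for l
  proof -
    define D where "D = {y \<in> A. \<exists>x\<in>A. l < f x \<and> R x y}"
    have sub: "{x. l < f x} \<subseteq> D"
      using supp that R(1) unfolding D_def by (force dest: reflpD)
    have sup: "D \<subseteq> {x. l < b * f x}"
      using f unfolding D_def by force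
    have "(\<integral>\<^sup>+x\<in>{x. l < f x}. u x \<partial>lebesgue) \<le> (\<integral>\<^sup>+x\<in>D. u x \<partial>lebesgue)"
      using sub by (intro nn_integral_mono) (auto split: split_indicator)
    also have "\<dots> \<le> (\<integral>\<^sup>+x\<in>D. v x \<partial>lebesgue)"
    proof (rule uv)
      fix x y assume "x \<in> D" "y \<in> A" "R x y"
      then show "y \<in> D" unfolding D_def using R(2) by (blast dest: transpD)
    qed (auto simp: D_def)
    also have "\<dots> \<le> (\<integral>\<^sup>+x\<in>{x. l < b * f x}. v x \<partial>lebesgue)"
      using sup by (intro nn_integral_mono) (auto split: split_indicator)
    finally show ?thesis .
  qed
  have "(\<integral>\<^sup>+x. ennreal (f x) * u x \<partial>lebesgue)
      = (\<integral>\<^sup>+l\<in>{0..}. (\<integral>\<^sup>+x\<in>{x. l < f x}. u x \<partial>lebesgue) \<partial>lborel)"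
    by (rule nn_integral_layer_cake[OF sigma_finite_lebesgue]) measurable
  also have "\<dots> \<le> (\<integral>\<^sup>+l\<in>{0..}. (\<integral>\<^sup>+x\<in>{x. l < b * f x}. v x \<partial>lebesgue) \<partial>lborel)"
    using level by (intro nn_integral_mono) (auto split: split_indicator)
  also have "\<dots> = (\<integral>\<^sup>+x. ennreal (b * f x) * v x \<partial>lebesgue)"
    by (rule nn_integral_layer_cake[OF sigma_finite_lebesgue, symmetric]) measurable
  also have "\<dots> = (\<integral>\<^sup>+x. ennreal b * (ennreal (f x) * v x) \<partial>lebesgue)"
    using \<open>0 \<le> b\<close> by (simp add: ennreal_mult' mult.assoc)
  also have "\<dots> = ennreal b * (\<integral>\<^sup>+x. ennreal (f x) * v x \<partial>lebesgue)"
    by (rule nn_integral_cmult) measurable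
  finally show ?thesis .
qed

section \<open>Power-weighted measures and adic scaling\<close>

text \<open>The exponent $p - 1$ is chosen so that dilation by $c$ scales the measure with $g = 1$ by $c^p$.
  The parameter $p$ is $a$ for the integrals near $0$ and $-a$ for those near infinity.\<close>

definition weighted :: "real \<Rightarrow> (real \<Rightarrow> real) \<Rightarrow> real measure" where
  "weighted p g = density lebesgue (\<lambda>t. ennreal (g t * t powr (p - 1)))"

lemma sets_weighted [simp, measurable_cong]: "sets (weighted p g) = sets lebesgue"
  by (simp add: weighted_def)

lemma measurable_powr_lebesgue [measurable]: "(\<lambda>t::real. t powr q) \<in> borel_measurable lebesgue"
  by (rule measurable_completion) measurable

lemma emeasure_weighted:
  assumes [measurable]: "g \<in> borel_measurable lebesgue" and "S \<in> sets lebesgue"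
  shows "emeasure (weighted p g) S = (\<integral>\<^sup>+t\<in>S. ennreal (g t * t powr (p - 1)) \<partial>lebesgue)"
  unfolding weighted_def using assms(2) by (intro emeasure_density) measurable

lemma null_sets_weighted_singleton:
  assumes [measurable]: "g \<in> borel_measurable lebesgue"
  shows "{x} \<in> null_sets (weighted p g)"
proof -
  have "absolutely_continuous lebesgue (weighted p g)"
    unfolding weighted_def by (rule absolutely_continuousI_density) measurable
  moreover have "{x} \<in> null_sets lebesgue"
    by (rule null_sets_completionI) (simp add: null_sets_def)
  ultimately show ?thesis
    by (auto simp: absolutely_continuous_def)
qed

lemma emeasure_weighted_Diff_singleton:
  assumes "g \<in> borel_measurable lebesgue" and "S \<in> sets lebesgue"
  shows "emeasure (weighted p g) (S - {x}) = emeasure (weighted p g) S"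
  using assms by (intro emeasure_Diff_null_set null_sets_weighted_singleton) auto

lemma emeasure_weighted_open_interval_0:
  assumes "0 < a" "0 < s"
  shows "emeasure (weighted a (\<lambda>_. 1)) {0<..<s} = ennreal (s powr a / a)"
proof -
  have "{0<..<s} = ({0..s} - {0}) - {s}" by auto
  then have "emeasure (weighted a (\<lambda>_. 1)) {0<..<s} = emeasure (weighted a (\<lambda>_. 1)) {0..s}"
    by (simp add: emeasure_weighted_Diff_singleton)
  also have "\<dots> = (\<integral>\<^sup>+t. ennreal (t powr (a - 1)) * indicator {0..s} t \<partial>lebesgue)"
    by (simp add: emeasure_weighted)
  also have "\<dots> = ennreal (s powr (a - 1 + 1) / (a - 1 + 1))"
    unfolding nn_integral_completion
    by (rule nn_integral_has_integral_lebesgue'[OF _ has_integral_powr_from_0]) (use assms in auto)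
  finally show ?thesis by simp
qed

lemma emeasure_weighted_tail:
  assumes "0 < a" "0 < s"
  shows "emeasure (weighted (- a) (\<lambda>_. 1)) {s<..} = ennreal (s powr (- a) / a)"
proof -
  have "{s<..} = {s..} - {s}" by auto
  then have "emeasure (weighted (-a) (\<lambda>_. 1)) {s<..} = emeasure (weighted (-a) (\<lambda>_. 1)) {s..}"
    by (simp add: emeasure_weighted_Diff_singleton)
  also have "\<dots> = (\<integral>\<^sup>+t. ennreal (t powr (- a - 1)) * indicator {s..} t \<partial>lebesgue)"
    by (simp add: emeasure_weighted)
  also have "\<dots> = ennreal (- (s powr (- a - 1 + 1)) / (- a - 1 + 1))"
    unfolding nn_integral_completion
    by (rule nn_integral_has_integral_lebesgue'[OF _ has_integral_powr_to_inf]) (use assms in auto)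
  finally show ?thesis by simp
qed

lemma lebesgue_sets_scale:
  fixes c :: real
  assumes "S \<in> sets lebesgue" "c \<noteq> 0"
  shows "(*) c ` S \<in> sets lebesgue"
proof -
  have "(*) c ` S = (*\<^sub>R) (inverse c) -` S"
  proof (intro equalityI subsetI)
    fix x assume "x \<in> (*\<^sub>R) (inverse c) -` S"
    then show "x \<in> (*) c ` S"
      using \<open>c \<noteq> 0\<close> by (intro image_eqI[of _ _ "inverse c * x"]) auto
  next
    fix x assume "x \<in> (*) c ` S"
    then obtain y where "y \<in> S" "x = c * y" by blast
    then show "x \<in> (*\<^sub>R) (inverse c) -` S" using \<open>c \<noteq> 0\<close> by (simp add: field_simps)
  qed
  then show ?thesis
    using measurable_sets[OF lebesgue_measurable_scaling[of "inverse c"] assms(1)] by simp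
qed

text \<open>Substitute $t \mapsto ct$ and use $g(ct) \le g(t)$. Through this inequality alone the adic
  monotonicity of $g$ enters the proof.\<close>

lemma emeasure_weighted_scale_le:
  assumes [measurable]: "g \<in> borel_measurable lebesgue" "S \<in> sets lebesgue"
    and S: "S \<subseteq> {0<..}" and "0 < c" and g: "adically_decreasing c g"
  shows "emeasure (weighted p g) ((*) c ` S) \<le> ennreal (c powr p) * emeasure (weighted p g) S"
proof -
  have [measurable]: "(*) c ` S \<in> sets lebesgue"
    using \<open>0 < c\<close> by (intro lebesgue_sets_scale) auto
  define w where "w t = ennreal (g t * t powr (p - 1))" for t
  have [measurable]: "w \<in> borel_measurable lebesgue" unfolding w_def by measurable
  have "emeasure (weighted p g) ((*) c ` S) = (\<integral>\<^sup>+t. w t * indicator ((*) c ` S) t \<partial>lebesgue)"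
    by (simp add: emeasure_weighted w_def)
  also have "\<dots> = ennreal c * (\<integral>\<^sup>+t. w (c * t) * indicator ((*) c ` S) (c * t) \<partial>lebesgue)"
    using \<open>0 < c\<close> by (subst nn_integral_real_affine_lebesgue[where c = c and t = 0]) auto
  also have "\<dots> \<le> ennreal c * (\<integral>\<^sup>+t. ennreal (c powr (p - 1)) * (w t * indicator S t) \<partial>lebesgue)"
  proof (intro mult_left_mono nn_integral_mono)
    fix t
    have "w (c * t) \<le> ennreal (c powr (p - 1)) * w t" if "t \<in> S"
    proof -
      have "0 < t" using S that by auto
      then have "g (c * t) * (c * t) powr (p - 1) \<le> c powr (p - 1) * (g t * t powr (p - 1))"
        using g \<open>0 < c\<close> by (auto simp: adically_decreasing_def powr_mult intro!: mult_right_mono)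
      then show ?thesis
        unfolding w_def by (subst ennreal_mult'[symmetric]) (auto intro: ennreal_leI)
    qed
    then show "w (c * t) * indicator ((*) c ` S) (c * t)
        \<le> ennreal (c powr (p - 1)) * (w t * indicator S t)"
      using \<open>0 < c\<close> by (auto split: split_indicator)
  qed auto
  also have "\<dots> = ennreal c * ennreal (c powr (p - 1)) * (\<integral>\<^sup>+t. w t * indicator S t \<partial>lebesgue)"
    by (subst nn_integral_cmult) (auto simp: mult.assoc)
  also have "ennreal c * ennreal (c powr (p - 1)) = ennreal (c powr p)"
    using \<open>0 < c\<close> by (simp add: ennreal_mult'[symmetric] powr_diff)
  also have "(\<integral>\<^sup>+t. w t * indicator S t \<partial>lebesgue) = emeasure (weighted p g) S"
    by (simp add: emeasure_weighted w_def)
  finally show ?thesis .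
qed

lemma adically_decreasing_power:
  assumes "adically_decreasing c g" "0 < c"
  shows "adically_decreasing (c ^ n) g"
proof (induction n)
  case (Suc n)
  show ?case unfolding adically_decreasing_def
  proof (intro allI impI)
    fix t :: real assume t: "0 < t"
    have "g (c * (c ^ n * t)) \<le> g (c ^ n * t)"
      using assms t by (auto simp: adically_decreasing_def)
    also have "\<dots> \<le> g t" using Suc t by (auto simp: adically_decreasing_def)
    finally show "g (c ^ Suc n * t) \<le> g t" by (simp add: mult.assoc)
  qed
qed (simp add: adically_decreasing_def)

text \<open>Rounding to powers of $c$: every $r \ge s$ lies within a factor $c$ below some $c^n s$. This rounding is
  the source of the dilated endpoint $cr$ in the estimates.\<close>

lemma power_between:
  fixes c s r :: real
  assumes "1 < c" "0 < s" "s \<le> r"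
  obtains n where "r \<le> c ^ n * s" "c ^ n * s \<le> c * r"
proof -
  define n where "n = (LEAST n. r \<le> c ^ n * s)"
  obtain m where "r / s < c ^ m" using real_arch_pow[OF \<open>1 < c\<close>] by blast
  then have "r \<le> c ^ m * s" using assms by (simp add: field_simps)
  then have 1: "r \<le> c ^ n * s" unfolding n_def by (rule LeastI)
  have "c ^ n * s \<le> c * r"
  proof (cases n)
    case 0
    have "1 * s \<le> c * r" using assms by (intro mult_mono) auto
    then show ?thesis using 0 by simp
  next
    case (Suc k)
    then have "\<not> r \<le> c ^ k * s" unfolding n_def by (intro not_less_Least) simp
    then show ?thesis using Suc assms by (simp add: mult.assoc)
  qed
  with 1 show ?thesis by (rule that)
qed

text \<open>If $r \le c^n s \le cr$, then $(0,r)$ lies in the dilate of $(0,s)$ by $c^n$, whose mass is at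
  most $c^{na}$ times that of $(0,s)$; and $c^{na} \le (cr/s)^a$.\<close>

lemma weighted_initial_ge:
  assumes "0 < a" "0 < s" "s \<le> r" "1 < c" and g: "g \<in> borel_measurable lebesgue"
    and "adically_decreasing c g"
  shows "ennreal ((s / (c * r)) powr a) * emeasure (weighted a g) {0<..<r}
      \<le> emeasure (weighted a g) {0<..<s}"
proof -
  obtain n where n: "r \<le> c ^ n * s" "c ^ n * s \<le> c * r"
    using power_between assms by metis
  have cn: "0 < c ^ n" using \<open>1 < c\<close> by simp
  have "{0<..<r} \<subseteq> (*) (c ^ n) ` {0<..<s}"
  proof
    fix x assume "x \<in> {0<..<r}"
    then have "x / c ^ n \<in> {0<..<s}" using n cn by (auto simp: field_simps)
    then show "x \<in> (*) (c ^ n) ` {0<..<s}"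
      using \<open>1 < c\<close> by (intro image_eqI[of _ _ "x / c ^ n"]) auto
  qed
  then have "emeasure (weighted a g) {0<..<r} \<le> emeasure (weighted a g) ((*) (c ^ n) ` {0<..<s})"
    using \<open>1 < c\<close> by (intro emeasure_mono) (auto intro: lebesgue_sets_scale)
  also have "\<dots> \<le> ennreal ((c ^ n) powr a) * emeasure (weighted a g) {0<..<s}"
    using assms cn by (intro emeasure_weighted_scale_le adically_decreasing_power) auto
  finally have "ennreal ((s / (c * r)) powr a) * emeasure (weighted a g) {0<..<r}
      \<le> ennreal ((s / (c * r)) powr a) * (ennreal ((c ^ n) powr a) * emeasure (weighted a g) {0<..<s})"
    by (rule mult_left_mono) simp
  also have "\<dots> = ennreal ((c ^ n * s / (c * r)) powr a) * emeasure (weighted a g) {0<..<s}"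
    using assms cn by (simp add: mult.assoc[symmetric] ennreal_mult'[symmetric] powr_mult[symmetric] mult_ac)
  also have "\<dots> \<le> ennreal 1 * emeasure (weighted a g) {0<..<s}"
    using assms n cn by (intro mult_right_mono ennreal_leI powr_le1) (auto simp: field_simps)
  finally show ?thesis by simp
qed

text \<open>Dual to the estimate near 0: $(s,\infty)$ lies in the dilate of $(r,\infty)$ by $c^n$ when
  $s/c \le c^n r \le s$, and the mass of the dilate carries the factor $c^{-na} \le (cr/s)^a$.\<close>

lemma weighted_tail_le:
  assumes "0 < a" "0 < r" "c * r \<le> s" "1 < c" and g: "g \<in> borel_measurable lebesgue"
    and "adically_decreasing c g"
  shows "emeasure (weighted (- a) g) {s<..}
      \<le> ennreal ((c * r / s) powr a) * emeasure (weighted (- a) g) {r<..}"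
proof -
  obtain n where n: "s / c \<le> c ^ n * r" "c ^ n * r \<le> c * (s / c)"
    by (rule power_between[of c r "s / c"]) (use assms in \<open>auto simp: field_simps\<close>)
  have cn: "0 < c ^ n" using \<open>1 < c\<close> by simp
  have s: "0 < s" using assms by (smt (verit) mult_pos_pos)
  have img: "(*) (c ^ n) ` {r<..} = {c ^ n * r<..}"
  proof (intro equalityI subsetI)
    fix x assume "x \<in> {c ^ n * r<..}"
    then have "x / c ^ n \<in> {r<..}" using cn by (simp add: field_simps)
    then show "x \<in> (*) (c ^ n) ` {r<..}"
      using \<open>1 < c\<close> by (intro image_eqI[of _ _ "x / c ^ n"]) auto
  qed (use cn in auto)
  have "emeasure (weighted (- a) g) {s<..} \<le> emeasure (weighted (- a) g) ((*) (c ^ n) ` {r<..})"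
    unfolding img using n assms by (intro emeasure_mono) auto
  also have "\<dots> \<le> ennreal ((c ^ n) powr (- a)) * emeasure (weighted (- a) g) {r<..}"
    using assms cn by (intro emeasure_weighted_scale_le adically_decreasing_power) auto
  also have "\<dots> \<le> ennreal ((s / (c * r)) powr (- a)) * emeasure (weighted (- a) g) {r<..}"
    using assms n s cn by (intro mult_right_mono ennreal_leI powr_mono2') (auto simp: field_simps)
  also have "(s / (c * r)) powr (- a) = (c * r / s) powr a"
    using assms s by (simp add: powr_divide powr_minus field_simps)
  finally show ?thesis .
qed

text \<open>The shells $c^n [r, cr]$ cover the tail and their masses are bounded by a geometric series with
  ratio $c^{-a} < 1$, so the first shell cannot be finite when the tail is infinite. This settles
  the case of infinite mass, in which passing to complements is impossible.\<close>

lemma weighted_shell_infinite: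
  assumes "0 < a" "0 < r" "1 < c" and g: "g \<in> borel_measurable lebesgue"
    and "adically_decreasing c g" and inf: "emeasure (weighted (- a) g) {r<..} = \<infinity>"
  shows "emeasure (weighted (- a) g) {r<..c * r} = \<infinity>"
proof (rule ccontr)
  define x where "x = emeasure (weighted (- a) g) {r..c * r}"
  have "{r<..c * r} = {r..c * r} - {r}" by auto
  then have x: "x = emeasure (weighted (- a) g) {r<..c * r}"
    unfolding x_def by (simp add: emeasure_weighted_Diff_singleton g)
  assume "emeasure (weighted (- a) g) {r<..c * r} \<noteq> \<infinity>"
  then have fin: "x \<noteq> \<infinity>" using x by simp
  define q where "q = c powr (- a)"
  have q: "0 < q" "q < 1" unfolding q_def using assms by (auto simp: powr_less_one)
  have cn: "0 < c ^ n" for n using \<open>1 < c\<close> by simp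
  have img: "(*) (c ^ n) ` {r..c * r} = {c ^ n * r..c ^ n * (c * r)}" for n
    using cn[of n] assms by (simp add: image_mult_atLeastAtMost)
  have cover: "{r<..} \<subseteq> (\<Union>n. (*) (c ^ n) ` {r..c * r})"
  proof
    fix t assume t: "t \<in> {r<..}"
    show "t \<in> (\<Union>n. (*) (c ^ n) ` {r..c * r})"
    proof (cases "t \<le> c * r")
      case True
      then show ?thesis using t by (intro UN_I[of 0]) auto
    next
      case False
      obtain n where "t / c \<le> c ^ n * r" "c ^ n * r \<le> c * (t / c)"
        by (rule power_between[of c r "t / c"]) (use assms False in \<open>auto simp: field_simps\<close>)
      then show ?thesis unfolding img using assms by (intro UN_I[of n]) (auto simp: field_simps)
    qed
  qed
  have "emeasure (weighted (- a) g) {r<..} \<le> emeasure (weighted (- a) g) (\<Union>n. (*) (c ^ n) ` {r..c * r})"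
    using cover by (intro emeasure_mono) (auto simp: img)
  also have "\<dots> \<le> (\<Sum>n. emeasure (weighted (- a) g) ((*) (c ^ n) ` {r..c * r}))"
    by (intro emeasure_subadditive_countably) (auto simp: img)
  also have "\<dots> \<le> (\<Sum>n. ennreal (q ^ n) * x)"
  proof (intro suminf_le)
    fix n
    have "emeasure (weighted (- a) g) ((*) (c ^ n) ` {r..c * r})
        \<le> ennreal ((c ^ n) powr (- a)) * x"
      unfolding x_def using assms cn
      by (intro emeasure_weighted_scale_le adically_decreasing_power) auto
    also have "(c ^ n) powr (- a) = q ^ n"
      unfolding q_def using assms by (simp add: powr_realpow[symmetric] powr_powr mult.commute)
    finally show "emeasure (weighted (- a) g) ((*) (c ^ n) ` {r..c * r}) \<le> ennreal (q ^ n) * x" .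
  qed auto
  also have "\<dots> = ennreal (1 / (1 - q)) * x"
  proof -
    have "(\<Sum>n. ennreal (q ^ n)) = ennreal (1 / (1 - q))"
      using q by (intro suminf_ennreal_eq geometric_sums) auto
    then show ?thesis by (simp only: ennreal_suminf_multc)
  qed
  also have "\<dots> < \<infinity>" using fin by (simp add: ennreal_mult_less_top less_top)
  finally show False using inf by simp
qed

section \<open>Comparison on lower and upper sets\<close>

text \<open>Here \<open>m1 + m2\<close> and \<open>n1 + n2\<close> split the total mass \<open>m\<close> of a measure and that of a probability
  measure along a set and its complement: a comparison on one part becomes the opposite comparison
  on the other.\<close>

lemma complement_le:
  fixes m n1 :: ennreal
  assumes "m1 + m2 = m" "n1 + n2 = 1" "m \<noteq> \<infinity>" "n1 * m \<le> m1"
  shows "m2 \<le> n2 * m"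
proof -
  have m: "n1 * m + n2 * m = m" using assms(2) by (simp flip: distrib_right)
  then have "n1 * m \<noteq> \<infinity>" using assms(3) by (auto simp: add_top)
  moreover have "n1 * m + m2 \<le> n1 * m + n2 * m"
    using assms(1) add_right_mono[OF assms(4), of m2] m by simp
  ultimately show ?thesis by (simp add: ennreal_add_left_cancel_le)
qed

lemma complement_ge:
  fixes m n1 :: ennreal
  assumes "m1 + m2 = m" "n1 + n2 = 1" "m \<noteq> \<infinity>" "m1 \<le> n1 * m"
  shows "n2 * m \<le> m2"
proof -
  have m: "n1 * m + n2 * m = m" using assms(2) by (simp flip: distrib_right)
  then have "n1 * m \<noteq> \<infinity>" using assms(3) by (auto simp: add_top)
  moreover have "n1 * m + n2 * m \<le> n1 * m + m2"
    using assms(1) add_right_mono[OF assms(4), of m2] m by simp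
  ultimately show ?thesis by (simp add: ennreal_add_left_cancel_le)
qed

lemma emeasure_split:
  assumes "S \<in> sets M" "A \<in> sets M"
  shows "emeasure M (S \<inter> A) + emeasure M (A - S) = emeasure M A"
  using assms by (subst plus_emeasure) (auto intro!: arg_cong[where f = "emeasure M"])

lemma lower_set_measurable:
  fixes S :: "real set"
  assumes "S \<subseteq> {0<..}" "\<And>x y. x \<in> S \<Longrightarrow> 0 < y \<Longrightarrow> y \<le> x \<Longrightarrow> y \<in> S"
  shows "S \<in> sets lebesgue"
proof -
  have "is_interval S" unfolding is_interval_1
    using assms by (meson greaterThan_iff less_le_trans subsetD)
  then show ?thesis by (intro sets_completionI_sets) (simp add: real_interval_borel_measurable)
qed

lemma upper_set_measurable:
  fixes S :: "real set"
  assumes "S \<subseteq> {0<..}" "\<And>x y. x \<in> S \<Longrightarrow> x \<le> y \<Longrightarrow> y \<in> S"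
  shows "S \<in> sets lebesgue"
proof -
  have "is_interval S" unfolding is_interval_1 using assms by blast
  then show ?thesis by (intro sets_completionI_sets) (simp add: real_interval_borel_measurable)
qed

text \<open>The constants in front of the integrals normalize the power weight: taking \<open>s = \<rho>\<close> below shows
  that $a \rho^{-a} t^{a-1}\,dt$ on $(0,\rho)$ and $a \rho^{a} t^{-a-1}\,dt$ on $(\rho,\infty)$
  are probability measures.\<close>

lemma weighted_initial_normalized:
  assumes "0 < a" "0 < \<rho>" "0 < s"
  shows "ennreal (a * \<rho> powr (- a)) * emeasure (weighted a (\<lambda>_. 1)) {0<..<s} = ennreal ((s / \<rho>) powr a)"
  using assms by (simp add: emeasure_weighted_open_interval_0 ennreal_mult'[symmetric] powr_divide
      powr_minus field_simps)

lemma weighted_tail_normalized: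
  assumes "0 < a" "0 < \<rho>" "0 < s"
  shows "ennreal (a * \<rho> powr a) * emeasure (weighted (- a) (\<lambda>_. 1)) {s<..} = ennreal ((\<rho> / s) powr a)"
  using assms by (simp add: emeasure_weighted_tail ennreal_mult'[symmetric] powr_divide
      powr_minus field_simps)

text \<open>Up to a null set, a nonempty lower set not containing $(0,r)$ is an interval $(0,s)$ with $s < r$. Its
  share of the power weight on $(0,cr)$ is $(s/cr)^a$, and \<open>weighted_initial_ge\<close> says that
  $g$ gives it at least this share.\<close>

lemma initial_lower_set:
  assumes a: "0 < a" and r: "0 < r" and c: "1 < c" and g: "g \<in> borel_measurable lebesgue"
    and ad: "adically_decreasing c g"
    and S: "S \<subseteq> {0<..}" "\<And>x y. x \<in> S \<Longrightarrow> 0 < y \<Longrightarrow> y \<le> x \<Longrightarrow> y \<in> S"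
  shows "ennreal (a * (c * r) powr (- a)) * emeasure (weighted a (\<lambda>_. 1)) (S \<inter> {0<..<c * r})
      * emeasure (weighted a g) {0<..<r} \<le> emeasure (weighted a g) (S \<inter> {0<..<r})"
    (is "?K * emeasure ?n (S \<inter> ?J) * ?T \<le> emeasure ?m _")
proof -
  have cr: "0 < c * r" using c r by simp
  have mS: "S \<in> sets lebesgue" using S by (rule lower_set_measurable)
  show ?thesis
  proof (cases "{0<..<r} \<subseteq> S")
    case True
    have "?K * emeasure ?n (S \<inter> ?J) \<le> ?K * emeasure ?n ?J"
      by (intro mult_left_mono emeasure_mono) auto
    also have "\<dots> = 1" using weighted_initial_normalized[OF a cr cr] c r by simp
    finally have "?K * emeasure ?n (S \<inter> ?J) * ?T \<le> 1 * ?T" by (rule mult_right_mono) simp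
    then show ?thesis using True by (simp add: Int_absorb1)
  next
    case False
    then obtain x0 where x0: "0 < x0" "x0 < r" "x0 \<notin> S"
      by (metis greaterThanLessThan_iff subsetI)
    show ?thesis
    proof (cases "S = {}")
      case False
      define s where "s = Sup S"
      have le: "x \<le> x0" if "x \<in> S" for x using S(2)[OF that] x0 by force
      then have bdd: "bdd_above S" unfolding bdd_above_def by blast
      have up: "x \<le> s" if "x \<in> S" for x using that bdd by (auto simp: s_def intro: cSup_upper)
      have s: "0 < s" "s < r"
      proof -
        show "0 < s" using False S(1) up by (force intro: less_le_trans)
        have "s \<le> x0" unfolding s_def using False le by (intro cSup_least) auto
        then show "s < r" using x0 by simp
      qed
      have sub: "{0<..<s} \<subseteq> S"
      proof
        fix t assume t: "t \<in> {0<..<s}"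
        then obtain x where "x \<in> S" "t < x"
          unfolding s_def using less_cSup_iff[OF False bdd, of t] by auto
        then show "t \<in> S" using S(2)[of x t] t by simp
      qed
      have "emeasure ?n (S \<inter> ?J) \<le> emeasure ?n {0<..s}"
        using up S(1) by (intro emeasure_mono) auto
      also have "\<dots> = emeasure ?n ({0<..s} - {s})" by (simp add: emeasure_weighted_Diff_singleton)
      also have "{0<..s} - {s} = {0<..<s}" by auto
      finally have "?K * emeasure ?n (S \<inter> ?J) * ?T \<le> ?K * emeasure ?n {0<..<s} * ?T"
        by (intro mult_right_mono mult_left_mono) auto
      also have "?K * emeasure ?n {0<..<s} = ennreal ((s / (c * r)) powr a)"
        by (rule weighted_initial_normalized) fact+
      also have "\<dots> * ?T \<le> emeasure ?m {0<..<s}"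
        using s by (intro weighted_initial_ge assms) auto
      also have "\<dots> \<le> emeasure ?m (S \<inter> {0<..<r})"
        using sub s mS by (intro emeasure_mono) auto
      finally show ?thesis .
    qed simp
  qed
qed

text \<open>Complement of the previous comparison when the mass of $(0,r)$ is finite. Otherwise the right-hand
  side is infinite as soon as the upper set meets $(0,r)$, because it then contains an interval
  reaching up to $cr$.\<close>

lemma initial_upper_set:
  assumes a: "0 < a" and r: "0 < r" and c: "1 < c" and g: "g \<in> borel_measurable lebesgue"
    and ad: "adically_decreasing c g"
    and S: "S \<subseteq> {0<..}" "\<And>x y. x \<in> S \<Longrightarrow> x \<le> y \<Longrightarrow> y \<in> S"
  shows "emeasure (weighted a g) (S \<inter> {0<..<r}) \<le>
    ennreal (a * (c * r) powr (- a)) * emeasure (weighted a (\<lambda>_. 1)) (S \<inter> {0<..<c * r})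
      * emeasure (weighted a g) {0<..<r}"
    (is "emeasure ?m _ \<le> ?K * emeasure ?n (S \<inter> ?J) * ?T")
proof -
  have cr: "0 < c * r" "r \<le> c * r" using c r by auto
  have mS: "S \<in> sets lebesgue" using S by (rule upper_set_measurable)
  show ?thesis
  proof (cases "?T = \<infinity>")
    case False
    define L where "L = {0<..} - S"
    have mL: "L \<in> sets lebesgue" unfolding L_def using mS by (intro sets.Diff) auto
    have diff: "A - L = S \<inter> A" if "A \<subseteq> {0<..}" for A using that S(1) by (auto simp: L_def)
    have sub: "{0<..<q} \<subseteq> {0<..}" for q :: real by auto
    have "emeasure ?m (L \<inter> {0<..<r}) + emeasure ?m ({0<..<r} - L) = ?T" using mL by (intro emeasure_split) auto
    then have M: "emeasure ?m (L \<inter> {0<..<r}) + emeasure ?m (S \<inter> {0<..<r}) = ?T" by (simp add: diff[OF sub])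
    have "emeasure ?n (L \<inter> ?J) + emeasure ?n (?J - L) = emeasure ?n ?J" using mL by (intro emeasure_split) auto
    then have N: "?K * emeasure ?n (L \<inter> ?J) + ?K * emeasure ?n (S \<inter> ?J) = 1"
      using weighted_initial_normalized[OF a cr(1) cr(1)] c r
      by (simp add: diff[OF sub] flip: distrib_left)
    have "?K * emeasure ?n (L \<inter> ?J) * ?T \<le> emeasure ?m (L \<inter> {0<..<r})"
      by (rule initial_lower_set[OF a r c g ad]) (use S(2) in \<open>force simp: L_def\<close>)+
    then show ?thesis by (rule complement_le[OF M N False])
  next
    case True
    show ?thesis
    proof (cases "S \<inter> {0<..<r} = {}")
      case False
      then obtain x where x: "x \<in> S" "0 < x" "x < r" by auto
      have "{x<..<c * r} \<subseteq> S \<inter> ?J" using S(2)[OF x(1)] x by auto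
      then have "emeasure ?n {x<..<c * r} \<le> emeasure ?n (S \<inter> ?J)" using mS by (intro emeasure_mono) auto
      moreover have "emeasure ?n {x<..<c * r} \<noteq> 0"
      proof
        \<comment> \<open>Otherwise $(0,x)$ would carry the whole power weight of $(0,cr)$, although its share
          is only $(x/cr)^a < 1$.\<close>
        assume 0: "emeasure ?n {x<..<c * r} = 0"
        have "emeasure ?n ?J = emeasure ?n (?J - {x})" by (simp add: emeasure_weighted_Diff_singleton)
        also have "\<dots> \<le> emeasure ?n ({0<..<x} \<union> {x<..<c * r})"
          by (intro emeasure_mono) auto
        also have "\<dots> \<le> emeasure ?n {0<..<x} + emeasure ?n {x<..<c * r}"
          by (intro emeasure_subadditive) auto
        finally have "?K * emeasure ?n ?J \<le> ?K * emeasure ?n {0<..<x}"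
          using 0 by (intro mult_left_mono) auto
        then have "(1::real) \<le> (x / (c * r)) powr a"
          using a c r cr x by (simp add: weighted_initial_normalized)
        moreover have "(x / (c * r)) powr a < 1 powr a"
        proof (intro powr_less_mono2)
          have "x < c * r" using x(3) cr(2) by (rule less_le_trans)
          then show "x / (c * r) < 1" using cr(1) by (simp only: divide_less_eq_1_pos)
        qed (use a x cr in auto)
        ultimately show False by simp
      qed
      ultimately have "emeasure ?n (S \<inter> ?J) \<noteq> 0" by auto
      moreover have "?K \<noteq> 0" using a c r by (simp add: ennreal_eq_0_iff not_le)
      ultimately show ?thesis using True by (simp add: ennreal_mult_eq_top_iff ennreal_mult_top)
    qed simp
  qed
qed

text \<open>Up to an endpoint, a nonempty upper set is a half-line $(s,\infty)$. For $s \le cr$ its share of the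
  power weight on $(cr,\infty)$ is 1; for $s > cr$ the share is $(cr/s)^a$, which is the factor in
  \<open>weighted_tail_le\<close>.\<close>

lemma tail_upper_set:
  assumes a: "0 < a" and r: "0 < r" and c: "1 < c" and g: "g \<in> borel_measurable lebesgue"
    and ad: "adically_decreasing c g"
    and S: "S \<subseteq> {0<..}" "\<And>x y. x \<in> S \<Longrightarrow> x \<le> y \<Longrightarrow> y \<in> S"
  shows "emeasure (weighted (- a) g) (S \<inter> {r<..}) \<le>
    ennreal (a * (c * r) powr a) * emeasure (weighted (- a) (\<lambda>_. 1)) (S \<inter> {c * r<..})
      * emeasure (weighted (- a) g) {r<..}"
    (is "emeasure ?m _ \<le> ?K * emeasure ?n (S \<inter> ?J) * ?T")
proof -
  have cr: "0 < c * r" "r \<le> c * r" using c r by auto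
  have mS: "S \<in> sets lebesgue" using S by (rule upper_set_measurable)
  show ?thesis
  proof (cases "S = {}")
    case False
    define s where "s = Inf S"
    have bdd: "bdd_below S" using S(1) by (auto intro!: bdd_belowI[of _ 0])
    have low: "s \<le> x" if "x \<in> S" for x using that bdd by (auto simp: s_def intro: cInf_lower)
    have sub: "{s<..} \<subseteq> S"
    proof
      fix t assume "t \<in> {s<..}"
      then obtain x where "x \<in> S" "x < t"
        unfolding s_def using cInf_less_iff[OF False bdd, of t] by auto
      then show "t \<in> S" using S(2)[of x t] by simp
    qed
    show ?thesis
    proof (cases "s \<le> c * r")
      case True
      have "emeasure ?m (S \<inter> {r<..}) \<le> 1 * ?T" using mS by (simp add: emeasure_mono)
      also have "1 = ?K * emeasure ?n ?J" using weighted_tail_normalized[OF a cr(1) cr(1)] c r by simp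
      also have "?J = S \<inter> ?J" using sub True by auto
      finally show ?thesis .
    next
      case False
      then have s: "0 < s" using cr by simp
      have "emeasure ?m (S \<inter> {r<..}) \<le> emeasure ?m {s..}" using low by (intro emeasure_mono) auto
      also have "\<dots> = emeasure ?m ({s..} - {s})" by (simp add: emeasure_weighted_Diff_singleton g)
      also have "{s..} - {s} = {s<..}" by auto
      also have "emeasure ?m {s<..} \<le> ennreal ((c * r / s) powr a) * ?T"
        using False by (intro weighted_tail_le assms) auto
      also have "ennreal ((c * r / s) powr a) = ?K * emeasure ?n {s<..}"
        using weighted_tail_normalized[OF a cr(1) s] by simp
      also have "?K * emeasure ?n {s<..} * ?T \<le> ?K * emeasure ?n (S \<inter> ?J) * ?T"
        using sub False mS by (intro mult_right_mono mult_left_mono emeasure_mono) auto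
      finally show ?thesis .
    qed
  qed simp
qed

text \<open>Complement of the previous comparison when the mass of $(r,\infty)$ is finite. If it is infinite
  and the lower set reaches beyond $cr$, then the set contains the shell $(r,cr]$, which has
  infinite mass by \<open>weighted_shell_infinite\<close>.\<close>

lemma tail_lower_set:
  assumes a: "0 < a" and r: "0 < r" and c: "1 < c" and g: "g \<in> borel_measurable lebesgue"
    and ad: "adically_decreasing c g"
    and S: "S \<subseteq> {0<..}" "\<And>x y. x \<in> S \<Longrightarrow> 0 < y \<Longrightarrow> y \<le> x \<Longrightarrow> y \<in> S"
  shows "ennreal (a * (c * r) powr a) * emeasure (weighted (- a) (\<lambda>_. 1)) (S \<inter> {c * r<..})
      * emeasure (weighted (- a) g) {r<..} \<le> emeasure (weighted (- a) g) (S \<inter> {r<..})"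
    (is "?K * emeasure ?n (S \<inter> ?J) * ?T \<le> emeasure ?m _")
proof -
  have cr: "0 < c * r" "r \<le> c * r" using c r by auto
  have mS: "S \<in> sets lebesgue" using S by (rule lower_set_measurable)
  show ?thesis
  proof (cases "?T = \<infinity>")
    case False
    define U where "U = {0<..} - S"
    have mU: "U \<in> sets lebesgue" unfolding U_def using mS by (intro sets.Diff) auto
    have diff: "A - U = S \<inter> A" if "A \<subseteq> {0<..}" for A using that S(1) by (auto simp: U_def)
    have "emeasure ?m (U \<inter> {r<..}) + emeasure ?m ({r<..} - U) = ?T" using mU by (intro emeasure_split) auto
    then have M: "emeasure ?m (U \<inter> {r<..}) + emeasure ?m (S \<inter> {r<..}) = ?T" using r by (simp add: diff)
    have "emeasure ?n (U \<inter> ?J) + emeasure ?n (?J - U) = emeasure ?n ?J" using mU by (intro emeasure_split) auto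
    then have N: "?K * emeasure ?n (U \<inter> ?J) + ?K * emeasure ?n (S \<inter> ?J) = 1"
      using weighted_tail_normalized[OF a cr(1) cr(1)] c r
      by (simp add: diff flip: distrib_left)
    have "emeasure ?m (U \<inter> {r<..}) \<le> ?K * emeasure ?n (U \<inter> ?J) * ?T"
      by (rule tail_upper_set[OF a r c g ad]) (use S(2) in \<open>force simp: U_def\<close>)+
    then show ?thesis by (rule complement_ge[OF M N False])
  next
    case True
    show ?thesis
    proof (cases "S \<inter> ?J = {}")
      case False
      then obtain x where x: "x \<in> S" "c * r < x" by auto
      have "{r<..c * r} \<subseteq> S \<inter> {r<..}" using S(2)[OF x(1)] x r by auto
      then have "emeasure ?m {r<..c * r} \<le> emeasure ?m (S \<inter> {r<..})" using mS by (intro emeasure_mono) auto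
      then show ?thesis using weighted_shell_infinite[OF a r c g ad True] by (simp add: top_unique)
    qed simp
  qed
qed

section \<open>The product estimates\<close>

text \<open>Apply the layer-cake comparison to the weight of $g$ on \<open>I\<close> and to the normalized power weight
  on \<open>J\<close> multiplied by the (possibly infinite) mass of $g$ on \<open>I\<close>. Integrating \<open>f\<close> against
  the latter produces the product of integrals.\<close>

lemma nn_integral_product_ge:
  assumes [measurable]: "f \<in> borel_measurable lebesgue" "g \<in> borel_measurable lebesgue"
      "I \<in> sets lebesgue" "J \<in> sets lebesgue"
    and pos: "0 < b" "0 \<le> K" "\<And>t. 0 \<le> f t" "\<And>t. 0 \<le> g t" and supp: "\<And>t. t \<le> 0 \<Longrightarrow> f t = 0"
    and f: "almost_decreasing b f"
    and dom: "\<And>S. S \<subseteq> {0<..} \<Longrightarrow> (\<And>x y. x \<in> S \<Longrightarrow> 0 < y \<Longrightarrow> y \<le> x \<Longrightarrow> y \<in> S) \<Longrightarrow>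
      ennreal K * emeasure (weighted p (\<lambda>_. 1)) (S \<inter> J) * emeasure (weighted p g) I
        \<le> emeasure (weighted p g) (S \<inter> I)"
  shows "ennreal (K / b) * (\<integral>\<^sup>+t\<in>I. ennreal (g t * t powr (p - 1)) \<partial>lebesgue) *
      (\<integral>\<^sup>+t\<in>J. ennreal (f t * t powr (p - 1)) \<partial>lebesgue)
    \<le> (\<integral>\<^sup>+t\<in>I. ennreal (g t * f t * t powr (p - 1)) \<partial>lebesgue)"
proof -
  define T where "T = (\<integral>\<^sup>+t\<in>I. ennreal (g t * t powr (p - 1)) \<partial>lebesgue)"
  have T: "emeasure (weighted p g) I = T" by (simp add: T_def emeasure_weighted)
  define u where "u t = ennreal K * T * (ennreal (t powr (p - 1)) * indicator J t)" for t
  define v where "v t = ennreal (g t * t powr (p - 1)) * indicator I t" for t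
  have [measurable]: "u \<in> borel_measurable lebesgue" "v \<in> borel_measurable lebesgue"
    unfolding u_def v_def by measurable
  have "(\<integral>\<^sup>+t. ennreal (f t) * u t \<partial>lebesgue) \<le> ennreal b * (\<integral>\<^sup>+t. ennreal (f t) * v t \<partial>lebesgue)"
  proof (rule nn_integral_mono_of_hereditary_sets[where A = "{0<..}" and R = "(\<ge>)"])
    fix S :: "real set" assume S: "S \<subseteq> {0<..}" "\<And>x y. x \<in> S \<Longrightarrow> y \<in> {0<..} \<Longrightarrow> y \<le> x \<Longrightarrow> y \<in> S"
    have mS [measurable]: "S \<in> sets lebesgue" by (rule lower_set_measurable) (use S in auto)
    have "(\<integral>\<^sup>+x. u x * indicator S x \<partial>lebesgue)
        = (\<integral>\<^sup>+x. ennreal K * T * (ennreal (1 * x powr (p - 1)) * indicator (S \<inter> J) x) \<partial>lebesgue)"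
      by (intro nn_integral_cong) (auto simp: u_def split: split_indicator)
    also have "\<dots> = ennreal K * emeasure (weighted p (\<lambda>_. 1)) (S \<inter> J) * T"
      by (subst nn_integral_cmult) (auto simp: emeasure_weighted mult_ac)
    also have "\<dots> \<le> emeasure (weighted p g) (S \<inter> I)"
      using dom[of S] S by (auto simp: T)
    also have "\<dots> = (\<integral>\<^sup>+x. v x * indicator S x \<partial>lebesgue)"
      by (subst emeasure_weighted) (auto simp: v_def intro!: nn_integral_cong split: split_indicator)
    finally show "(\<integral>\<^sup>+x\<in>S. u x \<partial>lebesgue) \<le> (\<integral>\<^sup>+x\<in>S. v x \<partial>lebesgue)" .
  qed (use pos supp f in \<open>auto simp: almost_decreasing_def reflp_def transp_def\<close>)
  also have "(\<integral>\<^sup>+t. ennreal (f t) * u t \<partial>lebesgue)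
      = (\<integral>\<^sup>+t. ennreal K * T * (ennreal (f t * t powr (p - 1)) * indicator J t) \<partial>lebesgue)"
    using pos by (intro nn_integral_cong) (simp add: u_def ennreal_mult' mult_ac)
  also have "\<dots> = ennreal K * T * (\<integral>\<^sup>+t\<in>J. ennreal (f t * t powr (p - 1)) \<partial>lebesgue)"
    by (rule nn_integral_cmult) measurable
  also have "(\<integral>\<^sup>+t. ennreal (f t) * v t \<partial>lebesgue)
      = (\<integral>\<^sup>+t\<in>I. ennreal (g t * f t * t powr (p - 1)) \<partial>lebesgue)"
    using pos by (intro nn_integral_cong) (simp add: v_def ennreal_mult' mult_ac)
  finally have "ennreal (1 / b) * (ennreal K * T * (\<integral>\<^sup>+t\<in>J. ennreal (f t * t powr (p - 1)) \<partial>lebesgue))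
      \<le> ennreal (1 / b) * (ennreal b * (\<integral>\<^sup>+t\<in>I. ennreal (g t * f t * t powr (p - 1)) \<partial>lebesgue))"
    by (rule mult_left_mono) simp
  moreover have "ennreal (1 / b) * ennreal b = 1" "ennreal (1 / b) * ennreal K = ennreal (K / b)"
    using pos by (simp_all flip: ennreal_mult')
  ultimately show ?thesis by (simp add: T_def flip: mult.assoc)
qed

lemma nn_integral_product_le:
  assumes [measurable]: "f \<in> borel_measurable lebesgue" "g \<in> borel_measurable lebesgue"
      "I \<in> sets lebesgue" "J \<in> sets lebesgue"
    and pos: "0 < b" "0 \<le> K" "\<And>t. 0 \<le> f t" "\<And>t. 0 \<le> g t" and supp: "\<And>t. t \<le> 0 \<Longrightarrow> f t = 0"
    and f: "almost_increasing b f"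
    and dom: "\<And>S. S \<subseteq> {0<..} \<Longrightarrow> (\<And>x y. x \<in> S \<Longrightarrow> x \<le> y \<Longrightarrow> y \<in> S) \<Longrightarrow>
      emeasure (weighted p g) (S \<inter> I) \<le>
      ennreal K * emeasure (weighted p (\<lambda>_. 1)) (S \<inter> J) * emeasure (weighted p g) I"
  shows "(\<integral>\<^sup>+t\<in>I. ennreal (g t * f t * t powr (p - 1)) \<partial>lebesgue) \<le>
    ennreal (K * b) * (\<integral>\<^sup>+t\<in>I. ennreal (g t * t powr (p - 1)) \<partial>lebesgue) *
      (\<integral>\<^sup>+t\<in>J. ennreal (f t * t powr (p - 1)) \<partial>lebesgue)"
proof -
  define T where "T = (\<integral>\<^sup>+t\<in>I. ennreal (g t * t powr (p - 1)) \<partial>lebesgue)"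
  have T: "emeasure (weighted p g) I = T" by (simp add: T_def emeasure_weighted)
  define u where "u t = ennreal K * T * (ennreal (t powr (p - 1)) * indicator J t)" for t
  define v where "v t = ennreal (g t * t powr (p - 1)) * indicator I t" for t
  have [measurable]: "u \<in> borel_measurable lebesgue" "v \<in> borel_measurable lebesgue"
    unfolding u_def v_def by measurable
  have "(\<integral>\<^sup>+t\<in>I. ennreal (g t * f t * t powr (p - 1)) \<partial>lebesgue)
      = (\<integral>\<^sup>+t. ennreal (f t) * v t \<partial>lebesgue)"
    using pos by (intro nn_integral_cong) (simp add: v_def ennreal_mult' mult_ac)
  also have "\<dots> \<le> ennreal b * (\<integral>\<^sup>+t. ennreal (f t) * u t \<partial>lebesgue)"
  proof (rule nn_integral_mono_of_hereditary_sets[where A = "{0<..}" and R = "(\<le>)"])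
    fix S :: "real set" assume S: "S \<subseteq> {0<..}" "\<And>x y. x \<in> S \<Longrightarrow> y \<in> {0<..} \<Longrightarrow> x \<le> y \<Longrightarrow> y \<in> S"
    have up: "y \<in> S" if "x \<in> S" "x \<le> y" for x y using S that by force
    have mS [measurable]: "S \<in> sets lebesgue" by (rule upper_set_measurable) (use S(1) up in auto)
    have "(\<integral>\<^sup>+x. v x * indicator S x \<partial>lebesgue) = emeasure (weighted p g) (S \<inter> I)"
      by (subst emeasure_weighted) (auto simp: v_def intro!: nn_integral_cong split: split_indicator)
    also have "\<dots> \<le> ennreal K * emeasure (weighted p (\<lambda>_. 1)) (S \<inter> J) * T"
      using dom[OF S(1) up] by (simp add: T)
    also have "\<dots> = (\<integral>\<^sup>+x. ennreal K * T * (ennreal (1 * x powr (p - 1)) * indicator (S \<inter> J) x) \<partial>lebesgue)"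
      by (subst nn_integral_cmult) (auto simp: emeasure_weighted mult_ac)
    also have "\<dots> = (\<integral>\<^sup>+x. u x * indicator S x \<partial>lebesgue)"
      by (intro nn_integral_cong) (auto simp: u_def split: split_indicator)
    finally show "(\<integral>\<^sup>+x\<in>S. v x \<partial>lebesgue) \<le> (\<integral>\<^sup>+x\<in>S. u x \<partial>lebesgue)" .
  qed (use pos supp f in \<open>auto simp: almost_increasing_def reflp_def transp_def\<close>)
  also have "(\<integral>\<^sup>+t. ennreal (f t) * u t \<partial>lebesgue)
      = (\<integral>\<^sup>+t. ennreal K * T * (ennreal (f t * t powr (p - 1)) * indicator J t) \<partial>lebesgue)"
    using pos by (intro nn_integral_cong) (simp add: u_def ennreal_mult' mult_ac)
  also have "\<dots> = ennreal K * T * (\<integral>\<^sup>+t\<in>J. ennreal (f t * t powr (p - 1)) \<partial>lebesgue)"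
    by (rule nn_integral_cmult) measurable
  finally show ?thesis using pos by (simp add: T_def ennreal_mult' mult_ac)
qed

text \<open>The functions are only given on the positive half-line; extending them by 0 makes them measurable
  on the whole line without affecting the integrals. The four estimates are then the comparisons
  on lower and upper sets fed into the layer-cake argument.\<close>

lemma
  fixes a r b c :: real and f g :: "real \<Rightarrow> real"
  assumes a: "0 < a" and r: "0 < r" and b: "0 < b" and c: "1 < c"
    and f: "f \<in> borel_measurable (lebesgue_on {0<..})" "\<And>t. 0 < t \<Longrightarrow> 0 \<le> f t"
    and g: "g \<in> borel_measurable (lebesgue_on {0<..})" "\<And>t. 0 < t \<Longrightarrow> 0 \<le> g t"
      "adically_decreasing c g"
  shows product_initial_ge: "almost_decreasing b f \<Longrightarrow>
      ennreal (a * (c * r) powr (- a) / b) *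
        (\<integral>\<^sup>+t\<in>{0<..<r}. ennreal (g t * t powr (a - 1)) \<partial>lebesgue) *
        (\<integral>\<^sup>+t\<in>{0<..<c * r}. ennreal (f t * t powr (a - 1)) \<partial>lebesgue)
      \<le> (\<integral>\<^sup>+t\<in>{0<..<r}. ennreal (g t * f t * t powr (a - 1)) \<partial>lebesgue)" (is "_ \<Longrightarrow> ?ge0")
    and product_tail_ge: "almost_decreasing b f \<Longrightarrow>
      ennreal (a * (c * r) powr a / b) *
        (\<integral>\<^sup>+t\<in>{r<..}. ennreal (g t * t powr (- a - 1)) \<partial>lebesgue) *
        (\<integral>\<^sup>+t\<in>{c * r<..}. ennreal (f t * t powr (- a - 1)) \<partial>lebesgue)
      \<le> (\<integral>\<^sup>+t\<in>{r<..}. ennreal (g t * f t * t powr (- a - 1)) \<partial>lebesgue)" (is "_ \<Longrightarrow> ?ge1")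
    and product_initial_le: "almost_increasing b f \<Longrightarrow>
      (\<integral>\<^sup>+t\<in>{0<..<r}. ennreal (g t * f t * t powr (a - 1)) \<partial>lebesgue)
      \<le> ennreal (a * (c * r) powr (- a) * b) *
        (\<integral>\<^sup>+t\<in>{0<..<r}. ennreal (g t * t powr (a - 1)) \<partial>lebesgue) *
        (\<integral>\<^sup>+t\<in>{0<..<c * r}. ennreal (f t * t powr (a - 1)) \<partial>lebesgue)" (is "_ \<Longrightarrow> ?le0")
    and product_tail_le: "almost_increasing b f \<Longrightarrow>
      (\<integral>\<^sup>+t\<in>{r<..}. ennreal (g t * f t * t powr (- a - 1)) \<partial>lebesgue)
      \<le> ennreal (a * (c * r) powr a * b) *
        (\<integral>\<^sup>+t\<in>{r<..}. ennreal (g t * t powr (- a - 1)) \<partial>lebesgue) *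
        (\<integral>\<^sup>+t\<in>{c * r<..}. ennreal (f t * t powr (- a - 1)) \<partial>lebesgue)" (is "_ \<Longrightarrow> ?le1")
proof -
  define F G where "F t = (if t \<in> {0<..} then f t else 0)" and "G t = (if t \<in> {0<..} then g t else 0)" for t
  have F: "F \<in> borel_measurable lebesgue" "\<And>t. 0 \<le> F t" "\<And>t. t \<le> 0 \<Longrightarrow> F t = 0"
    using borel_measurable_if_I[OF f(1)] f(2) by (auto simp: F_def[abs_def])
  have G: "G \<in> borel_measurable lebesgue" "\<And>t. 0 \<le> G t" "adically_decreasing c G"
    using borel_measurable_if_I[OF g(1)] g(2,3) c by (auto simp: G_def[abs_def] adically_decreasing_def)
  have eq: "(\<integral>\<^sup>+t\<in>A. ennreal (G t * F t * t powr q) \<partial>lebesgue) = (\<integral>\<^sup>+t\<in>A. ennreal (g t * f t * t powr q) \<partial>lebesgue)"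
    "(\<integral>\<^sup>+t\<in>A. ennreal (G t * t powr q) \<partial>lebesgue) = (\<integral>\<^sup>+t\<in>A. ennreal (g t * t powr q) \<partial>lebesgue)"
    "(\<integral>\<^sup>+t\<in>A. ennreal (F t * t powr q) \<partial>lebesgue) = (\<integral>\<^sup>+t\<in>A. ennreal (f t * t powr q) \<partial>lebesgue)"
    if "A \<subseteq> {0<..}" for A q
    using that by (auto intro!: nn_integral_cong simp: F_def G_def split: split_indicator)
  have cr: "0 < c * r" using c r by simp
  have sub: "{0<..<r} \<subseteq> {0<..}" "{0<..<c * r} \<subseteq> {0<..}" "{r<..} \<subseteq> {0<..}" "{c * r<..} \<subseteq> {0<..}"
    using r cr by auto
  show ?ge0 if f: "almost_decreasing b f"
  proof -
    have "ennreal (a * (c * r) powr (- a) / b) *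
        (\<integral>\<^sup>+t\<in>{0<..<r}. ennreal (G t * t powr (a - 1)) \<partial>lebesgue) *
        (\<integral>\<^sup>+t\<in>{0<..<c * r}. ennreal (F t * t powr (a - 1)) \<partial>lebesgue)
      \<le> (\<integral>\<^sup>+t\<in>{0<..<r}. ennreal (G t * F t * t powr (a - 1)) \<partial>lebesgue)"
    proof (rule nn_integral_product_ge)
      show "almost_decreasing b F" using f by (simp add: almost_decreasing_def F_def)
    qed (use F G a b in \<open>auto intro!: initial_lower_set[OF a r c G(1,3)]\<close>)
    then show ?thesis by (simp only: eq sub)
  qed
  show ?ge1 if f: "almost_decreasing b f"
  proof -
    have "ennreal (a * (c * r) powr a / b) *
        (\<integral>\<^sup>+t\<in>{r<..}. ennreal (G t * t powr (- a - 1)) \<partial>lebesgue) *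
        (\<integral>\<^sup>+t\<in>{c * r<..}. ennreal (F t * t powr (- a - 1)) \<partial>lebesgue)
      \<le> (\<integral>\<^sup>+t\<in>{r<..}. ennreal (G t * F t * t powr (- a - 1)) \<partial>lebesgue)"
    proof (rule nn_integral_product_ge)
      show "almost_decreasing b F" using f by (simp add: almost_decreasing_def F_def)
    qed (use F G a b in \<open>auto intro!: tail_lower_set[OF a r c G(1,3)]\<close>)
    then show ?thesis by (simp only: eq sub)
  qed
  show ?le0 if f: "almost_increasing b f"
  proof -
    have "(\<integral>\<^sup>+t\<in>{0<..<r}. ennreal (G t * F t * t powr (a - 1)) \<partial>lebesgue)
      \<le> ennreal (a * (c * r) powr (- a) * b) *
        (\<integral>\<^sup>+t\<in>{0<..<r}. ennreal (G t * t powr (a - 1)) \<partial>lebesgue) *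
        (\<integral>\<^sup>+t\<in>{0<..<c * r}. ennreal (F t * t powr (a - 1)) \<partial>lebesgue)"
    proof (rule nn_integral_product_le)
      show "almost_increasing b F" using f by (simp add: almost_increasing_def F_def)
    qed (use F G a b in \<open>auto intro!: initial_upper_set[OF a r c G(1,3)]\<close>)
    then show ?thesis by (simp only: eq sub)
  qed
  show ?le1 if f: "almost_increasing b f"
  proof -
    have "(\<integral>\<^sup>+t\<in>{r<..}. ennreal (G t * F t * t powr (- a - 1)) \<partial>lebesgue)
      \<le> ennreal (a * (c * r) powr a * b) *
        (\<integral>\<^sup>+t\<in>{r<..}. ennreal (G t * t powr (- a - 1)) \<partial>lebesgue) *
        (\<integral>\<^sup>+t\<in>{c * r<..}. ennreal (F t * t powr (- a - 1)) \<partial>lebesgue)"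
    proof (rule nn_integral_product_le)
      show "almost_increasing b F" using f by (simp add: almost_increasing_def F_def)
    qed (use F G a b in \<open>auto intro!: tail_upper_set[OF a r c G(1,3)]\<close>)
    then show ?thesis by (simp only: eq sub)
  qed
qed

theorem theorem2p16:
  fixes a r b c :: real and f g :: "real \<Rightarrow> real"
  assumes "0 < a" and "0 < r" and "1 < b" and "1 < c"
    and "f \<in> borel_measurable (lebesgue_on {0<..})" and "\<And>t. 0 < t \<Longrightarrow> 0 \<le> f t"
    and "g \<in> borel_measurable (lebesgue_on {0<..})" and "\<And>t. 0 < t \<Longrightarrow> 0 \<le> g t"
    and "adically_decreasing c g"
  shows
    "((almost_decreasing b f \<longrightarrow>
        (\<integral>\<^sup>+t\<in>{0<..<r}. ennreal (g t * f t * t powr (a - 1)) \<partial>lebesgue)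
          \<ge> ennreal (a * (c * r) powr (- a) / b ^ 3) *
            (\<integral>\<^sup>+t\<in>{0<..<r}. ennreal (g t * t powr (a - 1)) \<partial>lebesgue) *
            (\<integral>\<^sup>+t\<in>{0<..<c * r}. ennreal (f t * t powr (a - 1)) \<partial>lebesgue) \<and>
        (\<integral>\<^sup>+t\<in>{r<..}. ennreal (g t * f t * t powr (- a - 1)) \<partial>lebesgue)
          \<ge> ennreal (a * (c * r) powr a / b ^ 3) *
            (\<integral>\<^sup>+t\<in>{r<..}. ennreal (g t * t powr (- a - 1)) \<partial>lebesgue) *
            (\<integral>\<^sup>+t\<in>{c * r<..}. ennreal (f t * t powr (- a - 1)) \<partial>lebesgue)) \<and>
      (almost_increasing b f \<longrightarrow>
        (\<integral>\<^sup>+t\<in>{0<..<r}. ennreal (g t * f t * t powr (a - 1)) \<partial>lebesgue)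
          \<le> ennreal (a * (c * r) powr (- a) * b ^ 3) *
            (\<integral>\<^sup>+t\<in>{0<..<r}. ennreal (g t * t powr (a - 1)) \<partial>lebesgue) *
            (\<integral>\<^sup>+t\<in>{0<..<c * r}. ennreal (f t * t powr (a - 1)) \<partial>lebesgue) \<and>
        (\<integral>\<^sup>+t\<in>{r<..}. ennreal (g t * f t * t powr (- a - 1)) \<partial>lebesgue)
          \<le> ennreal (a * (c * r) powr a * b ^ 3) *
            (\<integral>\<^sup>+t\<in>{r<..}. ennreal (g t * t powr (- a - 1)) \<partial>lebesgue) *
            (\<integral>\<^sup>+t\<in>{c * r<..}. ennreal (f t * t powr (- a - 1)) \<partial>lebesgue))) \<and>
     (antimono_on {0<..} g \<longrightarrow>
      (almost_decreasing b f \<longrightarrow>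
        (\<integral>\<^sup>+t\<in>{0<..<r}. ennreal (g t * f t * t powr (a - 1)) \<partial>lebesgue)
          \<ge> ennreal (a * (c * r) powr (- a) / b) *
            (\<integral>\<^sup>+t\<in>{0<..<r}. ennreal (g t * t powr (a - 1)) \<partial>lebesgue) *
            (\<integral>\<^sup>+t\<in>{0<..<c * r}. ennreal (f t * t powr (a - 1)) \<partial>lebesgue) \<and>
        (\<integral>\<^sup>+t\<in>{r<..}. ennreal (g t * f t * t powr (- a - 1)) \<partial>lebesgue)
          \<ge> ennreal (a * (c * r) powr a / b) *
            (\<integral>\<^sup>+t\<in>{r<..}. ennreal (g t * t powr (- a - 1)) \<partial>lebesgue) *
            (\<integral>\<^sup>+t\<in>{c * r<..}. ennreal (f t * t powr (- a - 1)) \<partial>lebesgue)) \<and>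
      (almost_increasing b f \<longrightarrow>
        (\<integral>\<^sup>+t\<in>{0<..<r}. ennreal (g t * f t * t powr (a - 1)) \<partial>lebesgue)
          \<le> ennreal (a * (c * r) powr (- a) * b) *
            (\<integral>\<^sup>+t\<in>{0<..<r}. ennreal (g t * t powr (a - 1)) \<partial>lebesgue) *
            (\<integral>\<^sup>+t\<in>{0<..<c * r}. ennreal (f t * t powr (a - 1)) \<partial>lebesgue) \<and>
        (\<integral>\<^sup>+t\<in>{r<..}. ennreal (g t * f t * t powr (- a - 1)) \<partial>lebesgue)
          \<le> ennreal (a * (c * r) powr a * b) *
            (\<integral>\<^sup>+t\<in>{r<..}. ennreal (g t * t powr (- a - 1)) \<partial>lebesgue) *
            (\<integral>\<^sup>+t\<in>{c * r<..}. ennreal (f t * t powr (- a - 1)) \<partial>lebesgue)))"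
proof -
  have b: "0 < b" "b \<le> b ^ 3" using self_le_power[of b 3] \<open>1 < b\<close> by auto
  have weaken_ge: "ennreal (K / b ^ 3) * X * Y \<le> Z" if "ennreal (K / b) * X * Y \<le> Z" "0 \<le> K" for K X Y Z
  proof -
    have "K / b ^ 3 \<le> K / b" using that b by (intro divide_left_mono) auto
    then show ?thesis using that(1) by (meson ennreal_leI mult_right_mono order_trans zero_le)
  qed
  have weaken_le: "Z \<le> ennreal (K * b ^ 3) * X * Y" if "Z \<le> ennreal (K * b) * X * Y" "0 \<le> K" for K X Y Z
  proof -
    have "K * b \<le> K * b ^ 3" using that b by (intro mult_left_mono) auto
    then show ?thesis using that(1) by (meson ennreal_leI mult_right_mono order_trans zero_le)
  qed
  have K: "0 \<le> a * (c * r) powr (- a)" "0 \<le> a * (c * r) powr a" using \<open>0 < a\<close> by auto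
  note hyps = \<open>0 < a\<close> \<open>0 < r\<close> b(1) assms(4-9)
  show ?thesis
    by (intro conjI impI weaken_ge weaken_le K product_initial_ge product_tail_ge
        product_initial_le product_tail_le hyps)
qed

end
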